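(* Let $m\ge 2$ and $n\ge 1$ be integers, and let $L_{n,m}$ be the length of the longest common pattern contained in $m$ independent uniformly random permutations $\pi_1,\dots,\pi_m\in S_n$. Then $$\mathbb{E}(L_{n,m})\le\left\lceil e\,n^{\frac{m}{2m-1}}\right\rceil .$$
   Context: A permutation $\sigma=\sigma_1\cdots\sigma_k\in S_k$ (with $k\le n$) is a pattern contained in $\pi=\pi_1\cdots\pi_n\in S_n$ if there are indices $i_1<i_2<\dots<i_k$ such that $\pi_{i_1}\pi_{i_2}\cdots\pi_{i_k}$ is order isomorphic to $\sigma$, i.e. for all $a,b$, $\pi_{i_a}<\pi_{i_b}$ if and only if $\sigma_a<\sigma_b$. Given $\pi_1,\dots,\pi_m\in S_n$, a common pattern is a permutation $\sigma$ that is a pattern contained in all of the $\pi_i$; a longest common pattern is a common pattern of maximum length. Here $e$ is the base of the natural logarithm. *)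

theory Defs
  imports "HOL-Probability.Probability" "HOL-Combinatorics.Permutations"
begin

definition perms :: "nat \<Rightarrow> (nat \<Rightarrow> nat) set" where
  "perms n = {\<pi>. \<pi> permutes {1..n}}"

text \<open>
  Lengths are passed explicitly, since as a function on the naturals a permutation of
  \<open>{1..k}\<close> is also one of any larger interval.
\<close>

definition contains_pattern ::
    "nat \<Rightarrow> (nat \<Rightarrow> nat) \<Rightarrow> nat \<Rightarrow> (nat \<Rightarrow> nat) \<Rightarrow> bool" where
  "contains_pattern n \<pi> k \<sigma> \<longleftrightarrow>
     k \<le> n \<and> \<sigma> \<in> perms k \<and>
     (\<exists>i :: nat \<Rightarrow> nat.
        strict_mono_on {1..k} i \<and> i ` {1..k} \<subseteq> {1..n} \<and>
        (\<forall>a\<in>{1..k}. \<forall>b\<in>{1..k}. \<pi> (i a) < \<pi> (i b) \<longleftrightarrow> \<sigma> a < \<sigma> b))"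

definition common_pattern ::
    "nat \<Rightarrow> nat \<Rightarrow> (nat \<Rightarrow> nat \<Rightarrow> nat) \<Rightarrow> nat \<Rightarrow> (nat \<Rightarrow> nat) \<Rightarrow> bool" where
  "common_pattern n m \<pi> k \<sigma> \<longleftrightarrow> (\<forall>j\<in>{1..m}. contains_pattern n (\<pi> j) k \<sigma>)"

text \<open>
  For \<open>m \<ge> 1\<close> the set below is nonempty (it contains 0, via the empty pattern) and bounded
  by \<open>n\<close>, so the maximum is attained.
\<close>

definition lcp_length :: "nat \<Rightarrow> nat \<Rightarrow> (nat \<Rightarrow> nat \<Rightarrow> nat) \<Rightarrow> nat" where
  "lcp_length n m \<pi> = Max {k. \<exists>\<sigma>. common_pattern n m \<pi> k \<sigma>}"

text \<open>
  The joint law of \<open>m\<close> independent uniform permutations, indexed by \<open>{1..m}\<close>; the value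
  \<open>id\<close> taken outside that index set plays no role.
\<close>

definition random_perms :: "nat \<Rightarrow> nat \<Rightarrow> (nat \<Rightarrow> nat \<Rightarrow> nat) pmf" where
  "random_perms n m = Pi_pmf {1..m} id (\<lambda>_. pmf_of_set (perms n))"

end

theory Submission
  imports Defs
begin

text \<open>
  The proof is a first-moment argument. A fixed pattern of length \<open>k\<close> occurs in a uniformly
  random permutation of \<open>{1..n}\<close> with probability at most \<open>(n choose k) / k!\<close>: for each of the
  \<open>n choose k\<close> possible sets of positions, the relative order of the entries there is uniform among
  \<open>k!\<close> orders (lemmas \<open>card_order_isomorphic_permutations_le\<close> and \<open>card_containing_pattern_le\<close>).
  By independence, and by the union bound over the \<open>k!\<close> patterns, a common pattern of length \<open>k\<close>
  exists with probability at most \<open>k! ((n choose k) / k!)^m\<close>. Since \<open>n choose k \<le> n^k / k!\<close>, this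
  is at most \<open>(p^k / k!)^(2m-1)\<close>, where \<open>p = n^(m/(2m-1))\<close>
  (lemma \<open>prob_exists_common_pattern_le_power\<close>).

  Write the ceiling of \<open>e p\<close> as \<open>N + 1\<close>. The elementary bound \<open>k! \<ge> e (k/e)^k\<close> makes \<open>p^k / k!\<close>
  decay geometrically beyond \<open>N\<close>: for \<open>k = N + j\<close> with \<open>j \<ge> 1\<close> it is at most \<open>e^(-j)\<close> (lemma
  \<open>power_over_fact_le_exp\<close>). The leading factor \<open>e\<close> of that bound matters: \<open>k! \<ge> (k/e)^k\<close> alone
  only gives \<open>e^(1-j)\<close>, which says nothing about the probability at \<open>k = N + 1\<close>.

  Finally, the length \<open>L\<close> of the longest common pattern is at most \<open>N\<close> plus the sum of \<open>j\<close> over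
  those \<open>j \<ge> 1\<close> for which a common pattern of length \<open>N + j\<close> exists. Hence \<open>E(L)\<close> is at most
  \<open>N\<close> plus the sum of \<open>j e^(-(2m-1)j)\<close> over \<open>j \<ge> 1\<close>. As \<open>e^(-(2m-1)) \<le> 1/4\<close>, each summand is at
  most \<open>j 4^(-j) \<le> 2^(-j)\<close>, so that sum is at most 1 and \<open>E(L) \<le> N + 1\<close>.
\<close>

section \<open>Order isomorphic functions\<close>

text \<open>
  The rank of \<open>f x\<close> in the common image counts the arguments with a smaller value, so the order
  isomorphism determines it, and the rank determines \<open>f x\<close>.
\<close>

lemma order_isomorphic_with_same_image_imp_eq:
  fixes f g :: "'a \<Rightarrow> 'b::linorder"
  assumes fin: "finite I" and "inj_on f I" "inj_on g I" "f ` I = g ` I"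
    and iso: "\<And>x y. x \<in> I \<Longrightarrow> y \<in> I \<Longrightarrow> f x < f y \<longleftrightarrow> g x < g y"
    and x: "x \<in> I"
  shows "f x = g x"
proof -
  define J where "J = f ` I"
  have rank: "card {z \<in> J. z < h x} = card {y \<in> I. h y < h x}"
    if "inj_on h I" "h ` I = J" for h
  proof -
    have "{z \<in> J. z < h x} = h ` {y \<in> I. h y < h x}"
      using that by auto
    then show ?thesis
      using that by (auto intro!: card_image inj_on_subset[OF that(1)])
  qed
  have "{y \<in> I. f y < f x} = {y \<in> I. g y < g x}"
    using iso x by auto
  then have same_rank: "card {z \<in> J. z < f x} = card {z \<in> J. z < g x}"
    using rank[of f] rank[of g] assms by (simp add: J_def)
  have rank_mono: "card {z \<in> J. z < u} < card {z \<in> J. z < v}" if "u < v" "u \<in> J" for u v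
    using that fin by (intro psubset_card_mono) (auto simp: J_def)
  have "f x \<in> J" "g x \<in> J"
    using x \<open>f ` I = g ` I\<close> by (auto simp: J_def)
  then show ?thesis
    using rank_mono[of "f x" "g x"] rank_mono[of "g x" "f x"] same_rank
    by (cases "f x" "g x" rule: linorder_cases) simp_all
qed

section \<open>Permutations containing a fixed pattern\<close>

text \<open>
  Precomposing a permutation with a permutation of the positions \<open>I\<close> rearranges the entries at \<open>I\<close>.
  If all members of \<open>P\<close> show the same relative order on \<open>I\<close>, the rearranged permutation determines
  the rearrangement, so the \<open>(card I)!\<close> rearrangements of the members of \<open>P\<close> are distinct.
\<close>

lemma card_order_isomorphic_permutations_le:
  fixes P :: "('a::linorder \<Rightarrow> 'a) set"
  assumes S: "finite S" "I \<subseteq> S" and P: "\<And>\<pi>. \<pi> \<in> P \<Longrightarrow> \<pi> permutes S"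
    and iso: "\<And>\<pi> \<rho> x y. \<pi> \<in> P \<Longrightarrow> \<rho> \<in> P \<Longrightarrow> x \<in> I \<Longrightarrow> y \<in> I \<Longrightarrow> \<pi> x < \<pi> y \<longleftrightarrow> \<rho> x < \<rho> y"
  shows "card P * fact (card I) \<le> fact (card S)"
proof -
  have finI: "finite I"
    using S finite_subset by blast
  let ?T = "{\<tau>. \<tau> permutes I}" and ?F = "\<lambda>(\<pi>, \<tau>). \<pi> \<circ> \<tau>"
  have "inj_on ?F (P \<times> ?T)"
  proof (rule inj_onI, clarify)
    fix \<pi> \<tau> \<pi>' \<tau>'
    assume asm: "\<pi> \<in> P" "\<tau> permutes I" "\<pi>' \<in> P" "\<tau>' permutes I" "\<pi> \<circ> \<tau> = \<pi>' \<circ> \<tau>'"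
    have inj: "inj \<pi>" "inj \<tau>" "inj \<tau>'" "inj \<pi>'"
      using asm P by (blast intro: permutes_inj)+
    have "(\<pi> \<circ> \<tau>) x = (\<pi> \<circ> \<tau>') x" if "x \<in> I" for x
    proof (rule order_isomorphic_with_same_image_imp_eq[OF finI _ _ _ _ that])
      show "inj_on (\<pi> \<circ> \<tau>) I" "inj_on (\<pi> \<circ> \<tau>') I"
        using inj by (meson inj_compose inj_on_subset subset_UNIV)+
      show "(\<pi> \<circ> \<tau>) ` I = (\<pi> \<circ> \<tau>') ` I"
        using asm(2,4) by (simp add: permutes_image flip: image_image)
      fix x y assume "x \<in> I" "y \<in> I"
      then have in_I: "\<tau>' x \<in> I" "\<tau>' y \<in> I"
        using asm by (simp_all add: permutes_in_image)
      have "(\<pi> \<circ> \<tau>) x < (\<pi> \<circ> \<tau>) y \<longleftrightarrow> \<pi>' (\<tau>' x) < \<pi>' (\<tau>' y)"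
        using asm by simp
      also have "\<dots> \<longleftrightarrow> (\<pi> \<circ> \<tau>') x < (\<pi> \<circ> \<tau>') y"
        using iso[OF asm(3,1) in_I] by simp
      finally show "(\<pi> \<circ> \<tau>) x < (\<pi> \<circ> \<tau>) y \<longleftrightarrow> (\<pi> \<circ> \<tau>') x < (\<pi> \<circ> \<tau>') y" .
    qed
    then have "\<tau> x = \<tau>' x" if "x \<in> I" for x
      using that injD[OF inj(1), of "\<tau> x" "\<tau>' x"] by (metis comp_apply)
    then have "\<tau> x = \<tau>' x" for x
      using asm(2,4) by (cases "x \<in> I") (simp_all add: permutes_not_in)
    then have "\<tau> = \<tau>'" by blast
    moreover from this have "\<pi> = \<pi>'"
      using asm by (metis comp_assoc comp_id permutes_inv_o(1))
    ultimately show "\<pi> = \<pi>' \<and> \<tau> = \<tau>'" by blast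
  qed
  moreover have "?F ` (P \<times> ?T) \<subseteq> {\<pi>. \<pi> permutes S}"
    using P S by (auto intro!: permutes_compose intro: permutes_subset)
  ultimately have "card (P \<times> ?T) \<le> card {\<pi>. \<pi> permutes S}"
    using S finite_permutations by (intro card_inj_on_le) auto
  then show ?thesis
    using S finI by (simp add: card_cartesian_product card_permutations)
qed

lemma card_perms: "card (perms n) = fact n"
  by (simp add: perms_def card_permutations)

lemma finite_perms [simp]: "finite (perms n)"
  by (simp add: perms_def finite_permutations)

lemma perms_nonempty [simp]: "perms n \<noteq> {}"
  using permutes_id unfolding perms_def by blast

text \<open>
  An occurrence of \<open>\<sigma>\<close> is classified by its set \<open>I\<close> of positions, of which there are
  \<open>n choose k\<close>. The increasing enumeration of \<open>I\<close> is unique, so all permutations with an occurrence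
  of \<open>\<sigma>\<close> at \<open>I\<close> have the same relative order there.
\<close>

lemma card_containing_pattern_le:
  "card {\<pi> \<in> perms n. contains_pattern n \<pi> k \<sigma>} * fact k \<le> (n choose k) * fact n"
proof -
  define occ where "occ = (\<lambda>(\<pi> :: nat \<Rightarrow> nat) (i :: nat \<Rightarrow> nat). strict_mono_on {1..k} i \<and>
    (\<forall>a\<in>{1..k}. \<forall>b\<in>{1..k}. \<pi> (i a) < \<pi> (i b) \<longleftrightarrow> \<sigma> a < \<sigma> b))"
  define A where "A = (\<lambda>I. {\<pi> \<in> perms n. \<exists>i. occ \<pi> i \<and> i ` {1..k} = I})"
  define Is where "Is = {I. I \<subseteq> {1..n} \<and> card I = k}"
  have finA: "finite (A I)" for I
    by (auto simp: A_def)
  have finIs: "finite Is"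
    unfolding Is_def by (rule finite_subset[of _ "Pow {1..n}"]) auto
  have A_le: "card (A I) * fact k \<le> fact n" if "I \<in> Is" for I
  proof -
    have "card (A I) * fact (card I) \<le> fact (card {1..n})"
    proof (rule card_order_isomorphic_permutations_le)
      show "I \<subseteq> {1..n}" using that by (simp add: Is_def)
      show "\<pi> permutes {1..n}" if "\<pi> \<in> A I" for \<pi>
        using that by (simp add: A_def perms_def)
    next
      fix \<pi> \<rho> x y assume asm: "\<pi> \<in> A I" "\<rho> \<in> A I" "x \<in> I" "y \<in> I"
      from asm obtain i where i: "occ \<pi> i" "i ` {1..k} = I" by (auto simp: A_def)
      from asm obtain i' where i': "occ \<rho> i'" "i' ` {1..k} = I" by (auto simp: A_def)
      have mono: "strict_mono_on {1..k} i" "strict_mono_on {1..k} i'"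
        using i i' by (simp_all add: occ_def)
      have same: "i a = i' a" if "a \<in> {1..k}" for a
      proof (rule order_isomorphic_with_same_image_imp_eq[of "{1..k}" i i'])
        show "inj_on i {1..k}" "inj_on i' {1..k}"
          using mono by (auto intro: strict_mono_on_imp_inj_on)
        show "i a < i b \<longleftrightarrow> i' a < i' b" if "a \<in> {1..k}" "b \<in> {1..k}" for a b
          using mono that by (simp add: strict_mono_on_less)
      qed (use i i' that in auto)
      obtain a b where "a \<in> {1..k}" "b \<in> {1..k}" "x = i a" "y = i b"
        using asm i by auto
      then show "\<pi> x < \<pi> y \<longleftrightarrow> \<rho> x < \<rho> y"
        using i i' same by (simp add: occ_def)
    qed auto
    then show ?thesis using that by (simp add: Is_def)
  qed
  have "{\<pi> \<in> perms n. contains_pattern n \<pi> k \<sigma>} \<subseteq> (\<Union>I\<in>Is. A I)"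
  proof
    fix \<pi> assume "\<pi> \<in> {\<pi> \<in> perms n. contains_pattern n \<pi> k \<sigma>}"
    then obtain i where i: "\<pi> \<in> perms n" "occ \<pi> i" "i ` {1..k} \<subseteq> {1..n}"
      by (auto simp: contains_pattern_def occ_def)
    have "inj_on i {1..k}"
      using i by (auto simp: occ_def intro: strict_mono_on_imp_inj_on)
    then have "i ` {1..k} \<in> Is"
      using i by (auto simp: Is_def card_image)
    then show "\<pi> \<in> (\<Union>I\<in>Is. A I)"
      using i by (auto simp: A_def)
  qed
  then have "card {\<pi> \<in> perms n. contains_pattern n \<pi> k \<sigma>} \<le> card (\<Union>I\<in>Is. A I)"
    using finA finIs by (intro card_mono) auto
  also have "\<dots> \<le> (\<Sum>I\<in>Is. card (A I))"
    using finIs by (rule card_UN_le)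
  finally have "card {\<pi> \<in> perms n. contains_pattern n \<pi> k \<sigma>} * fact k
      \<le> (\<Sum>I\<in>Is. card (A I) * fact k)"
    by (simp flip: sum_distrib_right)
  also have "\<dots> \<le> (\<Sum>I\<in>Is. fact n)"
    using A_le by (intro sum_mono)
  also have "\<dots> = (n choose k) * fact n"
    by (simp add: Is_def n_subsets)
  finally show ?thesis .
qed

section \<open>The probability of a common pattern\<close>

lemma prob_contains_pattern_le:
  "measure_pmf.prob (pmf_of_set (perms n)) {\<pi>. contains_pattern n \<pi> k \<sigma>}
     \<le> real (n choose k) / fact k"
proof -
  have "real (card {\<pi> \<in> perms n. contains_pattern n \<pi> k \<sigma>} * fact k)
      \<le> real ((n choose k) * fact n)"
    using card_containing_pattern_le by (intro of_nat_mono)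
  moreover have "perms n \<inter> {\<pi>. contains_pattern n \<pi> k \<sigma>}
      = {\<pi> \<in> perms n. contains_pattern n \<pi> k \<sigma>}"
    by auto
  ultimately show ?thesis
    by (simp add: measure_pmf_of_set card_perms field_simps)
qed

lemma prob_exists_common_pattern_le:
  assumes "m \<ge> 1"
  shows "measure_pmf.prob (random_perms n m) {\<pi>. \<exists>\<sigma>. common_pattern n m \<pi> k \<sigma>}
     \<le> fact k * (real (n choose k) / fact k) ^ m"
proof -
  let ?M = "random_perms n m"
  have one: "measure_pmf.prob ?M {\<pi>. common_pattern n m \<pi> k \<sigma>}
      \<le> (real (n choose k) / fact k) ^ m" for \<sigma>
  proof -
    have "{\<pi>. common_pattern n m \<pi> k \<sigma>} = Pi {1..m} (\<lambda>_. {\<pi>. contains_pattern n \<pi> k \<sigma>})"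
      by (auto simp: common_pattern_def Pi_def)
    then have "measure_pmf.prob ?M {\<pi>. common_pattern n m \<pi> k \<sigma>}
        = measure_pmf.prob (pmf_of_set (perms n)) {\<pi>. contains_pattern n \<pi> k \<sigma>} ^ m"
      by (simp add: random_perms_def measure_Pi_pmf_Pi)
    then show ?thesis
      using prob_contains_pattern_le by (simp add: power_mono)
  qed
  have "{\<pi>. \<exists>\<sigma>. common_pattern n m \<pi> k \<sigma>} = (\<Union>\<sigma>\<in>perms k. {\<pi>. common_pattern n m \<pi> k \<sigma>})"
    using assms by (force simp: common_pattern_def contains_pattern_def)
  then have "measure_pmf.prob ?M {\<pi>. \<exists>\<sigma>. common_pattern n m \<pi> k \<sigma>}
      \<le> (\<Sum>\<sigma>\<in>perms k. measure_pmf.prob ?M {\<pi>. common_pattern n m \<pi> k \<sigma>})"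
    by (simp add: measure_UNION_le)
  also have "\<dots> \<le> (\<Sum>\<sigma>\<in>perms k. (real (n choose k) / fact k) ^ m)"
    using one by (intro sum_mono)
  finally show ?thesis
    by (simp add: card_perms)
qed

text \<open>
  The exponent \<open>m / (2m - 1)\<close> of the theorem is the one for which \<open>p\<close> satisfies the hypothesis on
  \<open>p\<close> here. It balances the \<open>n^(km)\<close> of the numerator with the \<open>2m - 1\<close> factors \<open>k!\<close> that remain in
  the denominator.
\<close>

lemma prob_exists_common_pattern_le_power:
  assumes "m \<ge> 1" and p: "p ^ (2 * m - 1) = real n ^ m"
  shows "measure_pmf.prob (random_perms n m) {\<pi>. \<exists>\<sigma>. common_pattern n m \<pi> k \<sigma>}
     \<le> (p ^ k / fact k) ^ (2 * m - 1)"
proof -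
  have "real ((n choose k) * fact k) \<le> real (n ^ k)"
    using binomial_fact_pow by (intro of_nat_mono)
  then have choose_le: "real (n choose k) \<le> real n ^ k / fact k"
    by (simp add: field_simps)
  have swap: "(x ^ a) ^ b = (x ^ b) ^ a" for x :: real and a b :: nat
    by (simp add: mult.commute flip: power_mult)
  obtain q where q: "m = Suc q"
    using assms(1) by (cases m) auto
  have "fact k * (real (n choose k) / fact k) ^ m \<le> fact k * (real n ^ k / fact k / fact k) ^ m"
    using choose_le by (intro mult_left_mono power_mono divide_right_mono) auto
  also have "\<dots> = (real n ^ k) ^ m / fact k ^ (2 * m - 1)"
  proof -
    have "2 * m - 1 = Suc (q + q)"
      by (simp add: q)
    then show ?thesis
      by (simp add: q power_add power_divide power_mult power2_eq_square)
  qed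
  also have "(real n ^ k) ^ m = (p ^ (2 * m - 1)) ^ k"
    by (simp only: p swap[of "real n" k])
  also have "\<dots> / fact k ^ (2 * m - 1) = (p ^ k / fact k) ^ (2 * m - 1)"
    by (simp only: power_divide swap[of p k])
  finally show ?thesis
    using prob_exists_common_pattern_le[OF assms(1), of n k] by linarith
qed

section \<open>Geometric decay\<close>

text \<open>
  Passing from \<open>k\<close> to \<open>k + 1\<close> multiplies the two sides by quantities whose ratio is
  \<open>(1 + 1/k)^k / e \<le> 1\<close>, and equality holds at \<open>k = 1\<close>.
\<close>

lemma exp_1_times_power_le_fact:
  assumes "k \<ge> 1"
  shows "exp 1 * (real k / exp 1) ^ k \<le> fact k"
  using assms
proof (induction k rule: nat_induct_at_least)
  case base
  show ?case by simp
next
  case (Suc k)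
  have "real (Suc k) = real k * (1 + 1 / real k)"
    using Suc.hyps by (simp add: field_simps)
  then have "exp 1 * (real (Suc k) / exp 1) ^ Suc k
      = real (Suc k) * (exp 1 * (real k / exp 1) ^ k) * ((1 + 1 / real k) ^ k / exp 1)"
    by (simp add: power_mult_distrib power_divide)
  also have "\<dots> \<le> real (Suc k) * fact k * 1"
    using Suc exp_ge_one_plus_x_over_n_power_n[of k 1] by (intro mult_mono) auto
  finally show ?case by simp
qed

text \<open>
  With \<open>k = N + j + 1\<close> the hypothesis says \<open>e p \<le> k - j\<close>, so \<open>(e p / k)^k \<le> (1 - j/k)^k \<le> e^(-j)\<close>.
  The leading factor of the lower bound for \<open>k!\<close> contributes one more factor \<open>1/e\<close>.
\<close>

lemma power_over_fact_le_exp: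
  assumes "p \<ge> 0" "exp 1 * p \<le> real (Suc N)"
  shows "p ^ (N + Suc j) / fact (N + Suc j) \<le> exp (-1) ^ Suc j"
proof -
  define k where "k = N + Suc j"
  have k: "k \<ge> 1" "real (Suc N) = real k - real j"
    by (auto simp: k_def)
  have "p ^ k / fact k \<le> p ^ k / (exp 1 * (real k / exp 1) ^ k)"
    using k assms exp_1_times_power_le_fact[OF k(1)] by (intro divide_left_mono) auto
  also have "\<dots> = exp (-1) * (exp 1 * p / real k) ^ k"
    using k by (simp add: power_divide power_mult_distrib exp_minus field_simps)
  also have "\<dots> \<le> exp (-1) * (1 - real j / real k) ^ k"
  proof (intro mult_left_mono power_mono)
    have "exp 1 * p / real k \<le> (real k - real j) / real k"
      using assms k by (intro divide_right_mono) auto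
    then show "exp 1 * p / real k \<le> 1 - real j / real k"
      using k by (simp add: diff_divide_distrib)
  qed (use assms in auto)
  also have "\<dots> \<le> exp (-1) * exp (- real j)"
    using k by (intro mult_left_mono exp_ge_one_minus_x_over_n_power_n) (auto simp: k_def)
  also have "\<dots> = exp (-1) ^ Suc j"
    by (simp flip: exp_add exp_of_nat_mult)
  finally show ?thesis by (simp add: k_def)
qed

text \<open>The crude estimate \<open>j \<le> 2^j\<close> reduces the sum to a geometric series of ratio \<open>1/2\<close>.\<close>

lemma sum_index_times_power_le_1:
  fixes r :: real
  assumes "0 \<le> r" "r \<le> 1 / 4"
  shows "(\<Sum>j<n. real (Suc j) * r ^ Suc j) \<le> 1"
proof -
  have "(\<Sum>j<n. real (Suc j) * r ^ Suc j) \<le> (\<Sum>j<n. (1 / 2) ^ Suc j)"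
  proof (rule sum_mono)
    fix j
    have "real (Suc j) \<le> 2 ^ Suc j"
      using of_nat_less_two_power[of "Suc j", where 'a = real] by linarith
    then have "real (Suc j) * r ^ Suc j \<le> 2 ^ Suc j * (1 / 4) ^ Suc j"
      using assms by (intro mult_mono power_mono) auto
    also have "\<dots> = (1 / 2) ^ Suc j"
      by (simp flip: power_mult_distrib)
    finally show "real (Suc j) * r ^ Suc j \<le> (1 / 2) ^ Suc j" .
  qed
  also have "\<dots> = 1 - (1 / 2 :: real) ^ n"
    by (induction n) auto
  finally show ?thesis
    using zero_le_power[of "1 / 2 :: real" n] by linarith
qed

section \<open>The expected length\<close>

lemma common_pattern_lcp_length:
  assumes "m \<ge> 1"
  shows "\<exists>\<sigma>. common_pattern n m \<pi> (lcp_length n m \<pi>) \<sigma>" and "lcp_length n m \<pi> \<le> n"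
proof -
  let ?K = "{k. \<exists>\<sigma>. common_pattern n m \<pi> k \<sigma>}"
  have "?K \<subseteq> {..n}"
    using assms by (force simp: common_pattern_def contains_pattern_def)
  moreover have "common_pattern n m \<pi> 0 id"
    by (auto simp: common_pattern_def contains_pattern_def perms_def strict_mono_on_def permutes_id)
  ultimately have "lcp_length n m \<pi> \<in> ?K"
    unfolding lcp_length_def by (intro Max_in) (auto intro: finite_subset)
  then show "\<exists>\<sigma>. common_pattern n m \<pi> (lcp_length n m \<pi>) \<sigma>" "lcp_length n m \<pi> \<le> n"
    using \<open>?K \<subseteq> {..n}\<close> by auto
qed

text \<open>
  If the longest common pattern is longer than \<open>N\<close>, its own length \<open>N + Suc j\<close> already contributes
  the whole excess \<open>Suc j\<close> to the sum. The more common way to bound the excess, by the number of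
  lengths above \<open>N\<close> that occur, would require shortening a common pattern to every smaller length.
\<close>

lemma lcp_length_le_sum_indicator:
  assumes "m \<ge> 1"
  shows "real (lcp_length n m \<pi>) \<le> real N +
    (\<Sum>j<n. real (Suc j) * indicator {\<pi>. \<exists>\<sigma>. common_pattern n m \<pi> (N + Suc j) \<sigma>} \<pi>)"
    (is "_ \<le> _ + (\<Sum>j<n. ?c j)")
proof (cases "lcp_length n m \<pi> \<le> N")
  case True
  moreover have "(\<Sum>j<n. ?c j) \<ge> 0"
    by (intro sum_nonneg) auto
  ultimately show ?thesis by linarith
next
  case False
  then obtain j where j: "lcp_length n m \<pi> = N + Suc j"
    by (metis add_Suc_right less_imp_Suc_add not_le)
  have "j < n"
    using common_pattern_lcp_length(2)[OF assms, of n \<pi>] j by simp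
  have "real (Suc j) = ?c j"
    using common_pattern_lcp_length(1)[OF assms, of n \<pi>] j by simp
  also have "\<dots> \<le> (\<Sum>j<n. ?c j)"
    using \<open>j < n\<close> by (intro member_le_sum) auto
  finally show ?thesis using j by simp
qed

lemma finite_set_pmf_random_perms: "finite (set_pmf (random_perms n m))"
proof -
  have "set_pmf (random_perms n m) = PiE_dflt {1..m} id (\<lambda>_. perms n)"
    by (simp add: random_perms_def set_Pi_pmf o_def)
  then show ?thesis by (simp add: finite_PiE_dflt)
qed

lemma expectation_lcp_length_le:
  assumes "m \<ge> 1"
  shows "measure_pmf.expectation (random_perms n m) (\<lambda>\<pi>. real (lcp_length n m \<pi>)) \<le> real N +
    (\<Sum>j<n. real (Suc j) * measure_pmf.prob (random_perms n m)
       {\<pi>. \<exists>\<sigma>. common_pattern n m \<pi> (N + Suc j) \<sigma>})"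
proof -
  let ?M = "random_perms n m" and ?E = "\<lambda>j. {\<pi>. \<exists>\<sigma>. common_pattern n m \<pi> (N + Suc j) \<sigma>}"
  have int: "integrable ?M f" for f :: "_ \<Rightarrow> real"
    using finite_set_pmf_random_perms by (rule integrable_measure_pmf_finite)
  have "measure_pmf.expectation ?M (\<lambda>\<pi>. real (lcp_length n m \<pi>))
      \<le> measure_pmf.expectation ?M (\<lambda>\<pi>. real N + (\<Sum>j<n. real (Suc j) * indicator (?E j) \<pi>))"
    using assms by (intro integral_mono int lcp_length_le_sum_indicator)
  also have "\<dots> = real N + (\<Sum>j<n. real (Suc j) * measure_pmf.prob ?M (?E j))"
    by (subst Bochner_Integration.integral_add[OF int int], subst Bochner_Integration.integral_sum[OF int])
      simp
  finally show ?thesis .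
qed

theorem theorem1:
  fixes m n :: nat
  assumes "m \<ge> 2" and "n \<ge> 1"
  shows "measure_pmf.expectation (random_perms n m) (\<lambda>\<pi>. real (lcp_length n m \<pi>))
           \<le> of_int \<lceil>exp 1 * real n powr (real m / (2 * real m - 1))\<rceil>"
proof -
  define p where "p = real n powr (real m / (2 * real m - 1))"
  define d where "d = 2 * m - 1"
  \<comment> \<open>One less than the bound, because the tail of the expectation contributes up to 1.\<close>
  define N where "N = nat \<lceil>exp 1 * p\<rceil> - 1"
  have d: "real d = 2 * real m - 1" "d \<ge> 3"
    using assms by (auto simp: d_def)
  have "p > 0"
    using assms by (simp add: p_def)
  then have ceiling_pos: "\<lceil>exp 1 * p\<rceil> > 0"
    by (simp add: zero_less_ceiling)
  then have ceiling_eq: "of_int \<lceil>exp 1 * p\<rceil> = real (Suc N)"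
    by (simp add: N_def)
  have "p ^ d = p powr real d"
    using \<open>p > 0\<close> by (simp add: powr_realpow)
  also have "\<dots> = real n ^ m"
    using d assms by (simp add: p_def powr_powr powr_realpow flip: d(1))
  finally have p_power: "p ^ (2 * m - 1) = real n ^ m"
    by (simp add: d_def)
  define r :: real where "r = exp (-1) ^ d"
  have "r \<le> exp (-1) ^ 2"
    unfolding r_def using d by (intro power_decreasing) auto
  also have "\<dots> \<le> (1 / 2) ^ 2"
    using exp_ge_add_one_self[of 1] by (intro power_mono) (auto simp: exp_minus field_simps)
  finally have r: "0 \<le> r" "r \<le> 1 / 4"
    by (simp_all add: r_def power2_eq_square)
  have tail: "measure_pmf.prob (random_perms n m) {\<pi>. \<exists>\<sigma>. common_pattern n m \<pi> (N + Suc j) \<sigma>}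
      \<le> r ^ Suc j" for j
  proof -
    have "exp 1 * p \<le> real (Suc N)"
      using ceiling_eq le_of_int_ceiling[of "exp 1 * p"] by linarith
    then have "(p ^ (N + Suc j) / fact (N + Suc j)) ^ d \<le> (exp (-1) ^ Suc j) ^ d"
      using \<open>p > 0\<close> by (intro power_mono power_over_fact_le_exp) auto
    also have "\<dots> = r ^ Suc j"
      by (simp only: r_def mult.commute flip: power_mult)
    finally show ?thesis
      using prob_exists_common_pattern_le_power[OF _ p_power, of "N + Suc j"] assms
      by (simp add: d_def)
  qed
  have "measure_pmf.expectation (random_perms n m) (\<lambda>\<pi>. real (lcp_length n m \<pi>)) \<le> real N +
    (\<Sum>j<n. real (Suc j) * measure_pmf.prob (random_perms n m)
       {\<pi>. \<exists>\<sigma>. common_pattern n m \<pi> (N + Suc j) \<sigma>})"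
    using assms by (intro expectation_lcp_length_le) simp
  also have "\<dots> \<le> real N + (\<Sum>j<n. real (Suc j) * r ^ Suc j)"
    by (intro add_left_mono sum_mono mult_left_mono tail) auto
  also have "\<dots> \<le> real N + 1"
    using sum_index_times_power_le_1[OF r] by simp
  finally show ?thesis
    using ceiling_eq by (simp add: p_def)
qed

end
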